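(* Let $R$ be a commutative associative ring containing the field of rational numbers, let $n,n'$ be positive integers and $n''$ a nonnegative integer. Let $\varphi(x)=(\varphi_1(x),\dots,\varphi_{n'}(x))$ be a polynomial map in the variables $x=(x_1,\dots,x_n)$ over $R$, and let $\psi(y)=(\psi_1(y),\dots,\psi_n(y))$ be a polynomial map in the variables $y=(y_1,\dots,y_{n''})$ over $R$. Let $(\varphi\circ\psi)(y)=(\varphi_1(\psi(y)),\dots,\varphi_{n'}(\psi(y)))$. Then the matrices $M_\varphi$, $M_\psi$, $M_{\varphi\circ\psi}$ of these polynomial maps satisfy $$M_{\varphi\circ\psi}=\mathrm{Exp}(M_\psi)\,M_\varphi .$$
   Context: For a nonnegative integer $n$, $I_n$ denotes the set of row $n$-tuples $\alpha=(\alpha_1,\dots,\alpha_n)$ of nonnegative integers ($I_0=\{0\}$); $|\alpha|=\alpha_1+\dots+\alpha_n$, $\alpha!=\alpha_1!\cdots\alpha_n!$; $\beta\ll\alpha$ means $\beta_i\le\alpha_i$ for all $i$, and then $\binom{\alpha}{\beta}=\frac{\alpha!}{\beta!(\alpha-\beta)!}$. For a commutative ring $S\supseteq\mathbb{Q}$, $M_{n,n'}(p,p';S)$ is the set of matrices $A=(A_{\alpha,\alpha'})$ with entries in $S$, rows indexed by $\alpha\in I_n$ with $|\alpha|=p$ and columns indexed by $\alpha'\in I_{n'}$ with $|\alpha'|=p'$. For $A\in M_{n,n'}(p,p';S)$ and $B\in M_{n,n'}(q,q';S)$, the product $A\bigodot B\in M_{n,n'}(p+q,p'+q';S)$ is defined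 by $$(A\bigodot B)_{\alpha,\alpha'}=\sum_{\beta,\beta'}\binom{\alpha}{\beta}A_{\beta,\beta'}B_{\alpha-\beta,\alpha'-\beta'},$$ the sum being over all $\beta\in I_n$, $\beta'\in I_{n'}$ with $|\beta|=p$, $|\beta'|=p'$, $\beta\ll\alpha$, $\beta'\ll\alpha'$. $\mathrm{Mat}_{n,n'}(S)$ is the set of block matrices $A=(A(p,p'))_{p,p'\ge0}$ with $A(p,p')\in M_{n,n'}(p,p';S)$; each $M_{n,n'}(p,p';S)$ is regarded as a subset of it (all other blocks zero). The product $\bigodot$ extends by $(A\bigodot B)(p,p')=\sum_{q\le p,q'\le p'}A(q,q')\bigodot B(p-q,p'-q')$; its identity element $1$ has $(0,0)$ block $1$ and all other blocks zero. $A^{(m)}$ is the $m$-th power of $A$ with respect to $\bigodot$ ($A^{(0)}=1$), and $\mathrm{Exp}(A)=\sum_{i=0}^\infty\frac{1}{i!}A^{(i)}$ whenever this has meaning. Juxtaposition denotes the ordinary product of (block) matrices: $(AB)(p,p')=\sum_q A(p,q)B(q,p')$. The row of variables $x=(x_1,\dots,x_n)$ is regarded as an element of $M_{n,n}(0,1;R[x])$ (columns indexed by the unit multiindices). A polynomial map $\varphi(x)=(\varphi_1(x),\dots,\varphi_{n'}(x))\in M_{n,n'}(0,1;R[x])$ is written uniquely as $\varphi(x)=\sum_{p\ge0}\frac{1}{p!}x^{(p)}M_\varphi(p,1)=\mathrm{Exp}(x)M_\varphi$, where $M_\varphi\in\mathrm{Mat}_{n,n'}(R)$ has $M_\varphi(p,p')=0$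 for $p'\ne1$ and only finitely many nonzero blocks $M_\varphi(p,1)$. $M_\varphi$ is called the matrix of the polynomial map $\varphi$. Similarly $\psi(y)=\mathrm{Exp}(y)M_\psi$ with $M_\psi\in\mathrm{Mat}_{n'',n}(R)$ and $(\varphi\circ\psi)(y)=\mathrm{Exp}(y)M_{\varphi\circ\psi}$ with $M_{\varphi\circ\psi}\in\mathrm{Mat}_{n'',n'}(R)$. *)

theory Defs
  imports Complex_Main "HOL-Library.Poly_Mapping"
begin

section \<open>Commutative rings containing the rational numbers\<close>

class comm_ring_rat = comm_ring_1 +
  assumes ex_rat_embedding:
    "\<exists>h :: rat \<Rightarrow> 'a. inj h \<and> h 1 = 1 \<and>
       (\<forall>a b. h (a + b) = h a + h b) \<and> (\<forall>a b. h (a * b) = h a * h b)"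

text \<open>The embedding is unique, since a unital ring homomorphism out of the rationals is.\<close>

definition rat_emb :: "rat \<Rightarrow> 'a::comm_ring_rat" where
  "rat_emb = (SOME h. inj h \<and> h 1 = 1 \<and>
       (\<forall>a b. h (a + b) = h a + h b) \<and> (\<forall>a b. h (a * b) = h a * h b))"

instance poly_mapping :: (comm_monoid_add, comm_ring_rat) comm_ring_rat
proof
  from ex_rat_embedding obtain h :: "rat \<Rightarrow> 'b" where h: "inj h" "h 1 = 1"
      "\<forall>a b. h (a + b) = h a + h b" "\<forall>a b. h (a * b) = h a * h b"
    by (elim exE conjE) (rule that)
  let ?h = "\<lambda>q. Poly_Mapping.single (0::'a) (h q)"
  have inj: "inj ?h"
  proof (rule injI)
    fix a b assume "?h a = ?h b"
    then have "Poly_Mapping.lookup (?h a) 0 = Poly_Mapping.lookup (?h b) 0" by (rule arg_cong)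
    then have "h a = h b" by (simp only: lookup_single_eq)
    then show "a = b" by (rule injD[OF h(1)])
  qed
  show "\<exists>k :: rat \<Rightarrow> 'a \<Rightarrow>\<^sub>0 'b. inj k \<and> k 1 = 1 \<and>
       (\<forall>a b. k (a + b) = k a + k b) \<and> (\<forall>a b. k (a * b) = k a * k b)"
  proof (intro exI[of _ ?h] conjI allI)
    show "?h 1 = 1" by (simp only: h(2) single_one)
    show "?h (a + b) = ?h a + ?h b" for a b by (simp only: h(3)[rule_format] single_add)
    show "?h (a * b) = ?h a * ?h b" for a b by (simp only: h(4)[rule_format] mult_single add_0)
  qed (rule inj)
qed


section \<open>Multiindices\<close>

text \<open>
  A multiindex in $I_n$ is a finitely supported function whose support lies in
  $\{0,\dots,n-1\}$; the variables and the components of maps are likewise numbered from 0.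
  Differences of multiindices are taken componentwise (truncated subtraction).
\<close>

type_synonym mindex = "nat \<Rightarrow>\<^sub>0 nat"

definition mindices :: "nat \<Rightarrow> mindex set" where
  "mindices n = {\<alpha>. Poly_Mapping.keys \<alpha> \<subseteq> {..<n}}"

definition msize :: "mindex \<Rightarrow> nat" where
  "msize \<alpha> = (\<Sum>i\<in>Poly_Mapping.keys \<alpha>. Poly_Mapping.lookup \<alpha> i)"

definition mindices_of_size :: "nat \<Rightarrow> nat \<Rightarrow> mindex set" where
  "mindices_of_size n p = {\<alpha> \<in> mindices n. msize \<alpha> = p}"

definition mle :: "mindex \<Rightarrow> mindex \<Rightarrow> bool" (infix "\<lless>" 50) where
  "\<beta> \<lless> \<alpha> \<longleftrightarrow> (\<forall>i. Poly_Mapping.lookup \<beta> i \<le> Poly_Mapping.lookup \<alpha> i)"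

definition mfact :: "mindex \<Rightarrow> nat" where
  "mfact \<alpha> = (\<Prod>i\<in>Poly_Mapping.keys \<alpha>. fact (Poly_Mapping.lookup \<alpha> i))"

text \<open>Only used for $\beta \ll \alpha$, in which case the division is exact.\<close>

definition mbinom :: "mindex \<Rightarrow> mindex \<Rightarrow> nat" where
  "mbinom \<alpha> \<beta> = mfact \<alpha> div (mfact \<beta> * mfact (\<alpha> - \<beta>))"

definition munit :: "nat \<Rightarrow> mindex" where
  "munit i = Poly_Mapping.single i 1"


section \<open>Blocks and block matrices\<close>

text \<open>
  Blocks are total functions vanishing off their index range, so that equality of functions
  is equality of matrices. The entry of the block $A(p,p')$ in row $\alpha$ and column
  $\alpha'$ is \<open>A p p' \<alpha> \<alpha>'\<close>.
\<close>

type_synonym 'a block = "mindex \<Rightarrow> mindex \<Rightarrow> 'a"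
type_synonym 'a bmat = "nat \<Rightarrow> nat \<Rightarrow> 'a block"

definition blocks :: "nat \<Rightarrow> nat \<Rightarrow> nat \<Rightarrow> nat \<Rightarrow> 'a::zero block set" where
  "blocks n n' p p' = {A. \<forall>\<alpha> \<alpha>'. A \<alpha> \<alpha>' \<noteq> 0 \<longrightarrow>
     \<alpha> \<in> mindices_of_size n p \<and> \<alpha>' \<in> mindices_of_size n' p'}"

definition bmats :: "nat \<Rightarrow> nat \<Rightarrow> 'a::zero bmat set" where
  "bmats n n' = {A. \<forall>p p'. A p p' \<in> blocks n n' p p'}"

text \<open>
  \<open>block_odot n n' p p' A B\<close> is the product of a block \<open>A\<close> in \<open>blocks n n' p p'\<close> with a block
  \<open>B\<close>; the size \<open>(q, q')\<close> of \<open>B\<close> is not needed, as \<open>B\<close> vanishes at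
  $(\alpha-\beta, \alpha'-\beta')$ unless $|\alpha| = p+q$ and $|\alpha'| = p'+q'$.
\<close>

definition block_odot ::
  "nat \<Rightarrow> nat \<Rightarrow> nat \<Rightarrow> nat \<Rightarrow> 'a::comm_ring_1 block \<Rightarrow> 'a block \<Rightarrow> 'a block" where
  "block_odot n n' p p' A B = (\<lambda>\<alpha> \<alpha>'.
     \<Sum>\<beta> | \<beta> \<in> mindices_of_size n p \<and> \<beta> \<lless> \<alpha>.
       \<Sum>\<beta>' | \<beta>' \<in> mindices_of_size n' p' \<and> \<beta>' \<lless> \<alpha>'.
         of_nat (mbinom \<alpha> \<beta>) * A \<beta> \<beta>' * B (\<alpha> - \<beta>) (\<alpha>' - \<beta>'))"

definition odot :: "nat \<Rightarrow> nat \<Rightarrow> 'a::comm_ring_1 bmat \<Rightarrow> 'a bmat \<Rightarrow> 'a bmat" where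
  "odot n n' A B = (\<lambda>p p' \<alpha> \<alpha>'.
     \<Sum>q\<le>p. \<Sum>q'\<le>p'. block_odot n n' q q' (A q q') (B (p - q) (p' - q')) \<alpha> \<alpha>')"

definition odot_one :: "'a::comm_ring_1 bmat" where
  "odot_one = (\<lambda>p p' \<alpha> \<alpha>'. if p = 0 \<and> p' = 0 \<and> \<alpha> = 0 \<and> \<alpha>' = 0 then 1 else 0)"

primrec odot_power :: "nat \<Rightarrow> nat \<Rightarrow> 'a::comm_ring_1 bmat \<Rightarrow> nat \<Rightarrow> 'a bmat" where
  "odot_power n n' A 0 = odot_one"
| "odot_power n n' A (Suc m) = odot n n' A (odot_power n n' A m)"

text \<open>
  The infinite sums below are formal: entry by entry, \<open>Sum_any\<close> adds up the nonzero terms,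
  and the sum is meaningful when there are only finitely many of them (otherwise \<open>Sum_any\<close>
  returns 0).
\<close>

definition Exp :: "nat \<Rightarrow> nat \<Rightarrow> 'a::comm_ring_rat bmat \<Rightarrow> 'a bmat" where
  "Exp n n' A = (\<lambda>p p' \<alpha> \<alpha>'.
     Sum_any (\<lambda>i. rat_emb (1 / fact i) * odot_power n n' A i p p' \<alpha> \<alpha>'))"

text \<open>\<open>n\<close> is the common inner dimension: columns of \<open>A\<close> and rows of \<open>B\<close>.\<close>

definition bmat_mult :: "nat \<Rightarrow> 'a::comm_ring_1 bmat \<Rightarrow> 'a bmat \<Rightarrow> 'a bmat" where
  "bmat_mult n A B = (\<lambda>p p' \<alpha> \<alpha>'.
     Sum_any (\<lambda>q. \<Sum>\<beta>\<in>mindices_of_size n q. A p q \<alpha> \<beta> * B q p' \<beta> \<alpha>'))"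

text \<open>The row $(v_0,\dots,v_{n-1})$ as a $(0,1)$ block, columns indexed by unit multiindices.\<close>

definition row_bmat :: "nat \<Rightarrow> (nat \<Rightarrow> 'a::comm_ring_1) \<Rightarrow> 'a bmat" where
  "row_bmat n v = (\<lambda>p p' \<alpha> \<alpha>'.
     \<Sum>j<n. if p = 0 \<and> p' = 1 \<and> \<alpha> = 0 \<and> \<alpha>' = munit j then v j else 0)"


section \<open>Polynomial maps and their matrices\<close>

text \<open>
  A polynomial is the finitely supported family of its coefficients, indexed by exponents;
  multiplication on this type is convolution.
\<close>

type_synonym 'a mpoly = "mindex \<Rightarrow>\<^sub>0 'a"

definition mpolys :: "nat \<Rightarrow> 'a::zero mpoly set" where
  "mpolys n = {f. Poly_Mapping.keys f \<subseteq> mindices n}"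

definition mconst :: "'a::zero \<Rightarrow> 'a mpoly" where
  "mconst c = Poly_Mapping.single 0 c"

definition mvar :: "nat \<Rightarrow> 'a::comm_ring_1 mpoly" where
  "mvar i = Poly_Mapping.single (munit i) 1"

text \<open>
  A polynomial map in \<open>n\<close> variables with \<open>m\<close> components; the values of \<open>\<phi>\<close> at indices
  \<open>j \<ge> m\<close> are irrelevant.
\<close>

definition poly_map :: "nat \<Rightarrow> nat \<Rightarrow> (nat \<Rightarrow> 'a::zero mpoly) \<Rightarrow> bool" where
  "poly_map n m \<phi> \<longleftrightarrow> (\<forall>j<m. \<phi> j \<in> mpolys n)"

definition mpoly_subst :: "(nat \<Rightarrow> 'a mpoly) \<Rightarrow> 'a::comm_ring_1 mpoly \<Rightarrow> 'a mpoly" where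
  "mpoly_subst \<psi> f =
     (\<Sum>\<alpha>\<in>Poly_Mapping.keys f. mconst (Poly_Mapping.lookup f \<alpha>) *
        (\<Prod>i\<in>Poly_Mapping.keys \<alpha>. \<psi> i ^ Poly_Mapping.lookup \<alpha> i))"

definition poly_map_comp :: "(nat \<Rightarrow> 'a::comm_ring_1 mpoly) \<Rightarrow> (nat \<Rightarrow> 'a mpoly) \<Rightarrow> nat \<Rightarrow> 'a mpoly" where
  "poly_map_comp \<phi> \<psi> = (\<lambda>j. mpoly_subst \<psi> (\<phi> j))"

text \<open>
  The last conjunct is $\varphi(x) = \mathrm{Exp}(x)\,M$, with the entries of \<open>M\<close> read as
  constant polynomials. There is exactly one such \<open>M\<close>: since the entry of $\mathrm{Exp}(x)$ in
  row 0, column $\alpha$ is $x^\alpha/\alpha!$, the entry of $M(|\alpha|,1)$ in row $\alpha$ and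
  column \<open>munit j\<close> has to be $\alpha!$ times the coefficient of $x^\alpha$ in $\varphi_j$.
\<close>

definition is_matrix_of_map ::
  "nat \<Rightarrow> nat \<Rightarrow> (nat \<Rightarrow> 'a::comm_ring_rat mpoly) \<Rightarrow> 'a bmat \<Rightarrow> bool" where
  "is_matrix_of_map n m \<phi> M \<longleftrightarrow>
     M \<in> bmats n m \<and>
     (\<forall>p p'. p' \<noteq> 1 \<longrightarrow> M p p' = (\<lambda>\<alpha> \<alpha>'. 0)) \<and>
     finite {p. M p 1 \<noteq> (\<lambda>\<alpha> \<alpha>'. 0)} \<and>
     row_bmat m \<phi> =
       bmat_mult n (Exp n n (row_bmat n mvar)) (\<lambda>p p' \<alpha> \<alpha>'. mconst (M p p' \<alpha> \<alpha>'))"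

definition matrix_of_map ::
  "nat \<Rightarrow> nat \<Rightarrow> (nat \<Rightarrow> 'a::comm_ring_rat mpoly) \<Rightarrow> 'a bmat" where
  "matrix_of_map n m \<phi> = (THE M. is_matrix_of_map n m \<phi> M)"

end

theory Submission
  imports Defs
begin

text \<open>
  The matrix of $\psi$ is its table of Taylor coefficients: the entry in row $\alpha$ and column
  \<open>munit j\<close> is $\alpha!\,[y^\alpha]\psi_j$. Because of these factorials, the binomial
  coefficient in the product $\odot$ turns into convolution: $\binom{\alpha}{\beta}\,\beta!\,
  (\alpha-\beta)! = \alpha!$, so if the columns of two matrices list the numbers
  $\alpha!\,[y^\alpha]f$ and $\alpha!\,[y^\alpha]g$, then $\odot$ produces the numbers
  $\alpha!\,[y^\alpha](fg)$, where the column indices are added. Hence $\odot$-powers of $M_\psi$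
  contain the monomials in the components of $\psi$, and $\mathrm{Exp}(M_\psi)$ is the table of
  all divided powers: its entry in row $\alpha$ and column $\alpha'$ is
  $\alpha!\,[y^\alpha]\,\psi^{\alpha'}/\alpha'!$ (lemma \<open>Exp_taylor_bmat\<close>).

  Multiplying by $M_\varphi$, whose entry in row $\beta$ is $\beta!\,[x^\beta]\varphi_j$, cancels
  the $\beta!$ and leaves $\alpha!\,[y^\alpha]\sum_\beta [x^\beta]\varphi_j\;\psi^\beta$, the
  Taylor coefficients of $\varphi_j(\psi(y))$ (lemma \<open>Exp_mult_taylor_bmat\<close>).

  The matrix of a map is characterised by $\varphi(x)=\mathrm{Exp}(x)M$, so this argument needs
  that the table of Taylor coefficients is the one solution (lemma
  \<open>matrix_of_map_eq_taylor_bmat\<close>). The same computation of Exp gives this as well: the row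
  $x$ over $R[x]$ is the Taylor table of the constant map with components $x_j$, so
  $\mathrm{Exp}(x)$ has the single nonzero row $(x^\alpha/\alpha!)_\alpha$, and the product with
  $M$ can be read off coefficient by coefficient.
\<close>

abbreviation lookup where "lookup \<equiv> Poly_Mapping.lookup"
abbreviation keys where "keys \<equiv> Poly_Mapping.keys"

section \<open>The rational scalars\<close>

lemma rat_emb_hom:
  shows rat_emb_1: "rat_emb 1 = (1::'a::comm_ring_rat)"
    and rat_emb_add: "rat_emb (a + b) = (rat_emb a + rat_emb b :: 'a)"
    and rat_emb_mult: "rat_emb (a * b) = (rat_emb a * rat_emb b :: 'a)"
proof -
  have "inj (rat_emb :: rat \<Rightarrow> 'a) \<and> rat_emb 1 = (1::'a) \<and>
      (\<forall>a b. rat_emb (a + b) = (rat_emb a + rat_emb b :: 'a)) \<and>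
      (\<forall>a b. rat_emb (a * b) = (rat_emb a * rat_emb b :: 'a))"
    unfolding rat_emb_def by (rule someI_ex[OF ex_rat_embedding])
  then show "rat_emb 1 = (1::'a)" "rat_emb (a + b) = (rat_emb a + rat_emb b :: 'a)"
    "rat_emb (a * b) = (rat_emb a * rat_emb b :: 'a)"
    by blast+
qed

lemma rat_emb_0: "rat_emb 0 = (0::'a::comm_ring_rat)"
  using rat_emb_add[of 0 0, where 'a='a] by simp

lemma rat_emb_of_nat: "rat_emb (of_nat k) = (of_nat k :: 'a::comm_ring_rat)"
  by (induction k) (simp_all add: rat_emb_0 rat_emb_1 rat_emb_add)

lemma of_nat_mult_rat_emb_inverse:
  assumes "k > 0"
  shows "of_nat k * rat_emb (1 / of_nat k) = (1::'a::comm_ring_rat)"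
proof -
  have "of_nat k * rat_emb (1 / of_nat k) = (rat_emb (of_nat k * (1 / of_nat k)) :: 'a)"
    by (simp only: rat_emb_of_nat rat_emb_mult)
  then show ?thesis using assms by (simp add: rat_emb_1)
qed

lemma rat_emb_inverse_unique:
  fixes u :: "'a::comm_ring_rat"
  assumes "k > 0" and "of_nat k * u = 1"
  shows "u = rat_emb (1 / of_nat k)"
proof -
  have "u = (of_nat k * rat_emb (1 / of_nat k)) * u"
    by (simp only: of_nat_mult_rat_emb_inverse[OF assms(1)] mult_1_left)
  also have "\<dots> = rat_emb (1 / of_nat k) * (of_nat k * u)"
    by (simp only: ac_simps)
  finally show ?thesis by (simp only: assms(2) mult_1_right)
qed

text \<open>
  \<open>rat_emb\<close> is a choice function for each ring separately, so its values in $R$ and in $R[x]$ are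
  related only because inverses of positive integers are unique.
\<close>

lemma rat_emb_inverse_mpoly:
  assumes "k > 0"
  shows "rat_emb (1 / of_nat k) = (mconst (rat_emb (1 / of_nat k)) :: 'a::comm_ring_rat mpoly)"
proof (rule rat_emb_inverse_unique[OF assms, symmetric])
  show "of_nat k * mconst (rat_emb (1 / of_nat k)) = (1 :: 'a mpoly)"
    unfolding mconst_def single_of_nat[symmetric] mult_single
    by (simp only: of_nat_mult_rat_emb_inverse[OF assms] add_0 single_one)
qed

section \<open>Multiindices\<close>

lemma finite_bounded_mindices:
  assumes "finite K"
  shows "finite {\<beta>::mindex. keys \<beta> \<subseteq> K \<and> (\<forall>i. lookup \<beta> i \<le> b)}"
proof (rule finite_imageD)
  have "finite {f. \<forall>i. (i \<in> K \<longrightarrow> f i \<in> {..b}) \<and> (i \<notin> K \<longrightarrow> f i = 0)}"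
    using assms by (intro finite_set_of_finite_funs) auto
  then show "finite (lookup ` {\<beta>::mindex. keys \<beta> \<subseteq> K \<and> (\<forall>i. lookup \<beta> i \<le> b)})"
    by (rule rev_finite_subset) (auto simp: in_keys_iff)
  show "inj_on lookup {\<beta>::mindex. keys \<beta> \<subseteq> K \<and> (\<forall>i. lookup \<beta> i \<le> b)}"
    by (rule inj_onI) (simp add: lookup_inject)
qed

lemma msize_superset:
  assumes "finite K" "keys \<alpha> \<subseteq> K"
  shows "msize \<alpha> = (\<Sum>i\<in>K. lookup \<alpha> i)"
  unfolding msize_def using assms by (intro sum.mono_neutral_left) (auto simp: in_keys_iff)

lemma mfact_superset:
  assumes "finite K" "keys \<alpha> \<subseteq> K"
  shows "mfact \<alpha> = (\<Prod>i\<in>K. fact (lookup \<alpha> i))"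
  unfolding mfact_def using assms by (intro prod.mono_neutral_left) (auto simp: in_keys_iff)

lemma mfact_pos: "mfact \<alpha> > 0"
  unfolding mfact_def by (simp add: prod_pos)

lemma mle_keys: "\<beta> \<lless> \<alpha> \<Longrightarrow> keys \<beta> \<subseteq> keys \<alpha>"
  unfolding mle_def by (metis in_keys_iff le_zero_eq subsetI)

lemma keys_mindex_diff: "keys (\<alpha> - \<beta> :: mindex) \<subseteq> keys \<alpha>"
  by (auto simp: in_keys_iff lookup_minus)

lemma finite_mle: "finite {\<beta>. \<beta> \<lless> \<alpha>}"
proof (rule finite_subset)
  show "{\<beta>. \<beta> \<lless> \<alpha>} \<subseteq> {\<beta>. keys \<beta> \<subseteq> keys \<alpha> \<and> (\<forall>i. lookup \<beta> i \<le> msize \<alpha>)}"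
  proof (intro Collect_mono impI conjI allI)
    fix \<beta> i assume \<beta>: "\<beta> \<lless> \<alpha>"
    then show "keys \<beta> \<subseteq> keys \<alpha>" by (rule mle_keys)
    have "lookup \<alpha> i \<le> msize \<alpha>" unfolding msize_def
      by (cases "i \<in> keys \<alpha>") (auto simp: in_keys_iff intro: member_le_sum)
    then show "lookup \<beta> i \<le> msize \<alpha>" using \<beta> unfolding mle_def by (meson le_trans)
  qed
qed (simp add: finite_bounded_mindices)

lemma finite_mindices_of_size: "finite (mindices_of_size n p)"
proof (rule finite_subset)
  show "mindices_of_size n p \<subseteq> {\<beta>. keys \<beta> \<subseteq> {..<n} \<and> (\<forall>i. lookup \<beta> i \<le> p)}"
  proof
    fix \<beta> assume "\<beta> \<in> mindices_of_size n p"
    then have \<beta>: "keys \<beta> \<subseteq> {..<n}" "msize \<beta> = p"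
      by (auto simp: mindices_of_size_def mindices_def)
    have "lookup \<beta> i \<le> p" for i unfolding \<beta>(2)[symmetric] msize_def
      by (cases "i \<in> keys \<beta>") (auto simp: in_keys_iff intro: member_le_sum)
    with \<beta> show "\<beta> \<in> {\<beta>. keys \<beta> \<subseteq> {..<n} \<and> (\<forall>i. lookup \<beta> i \<le> p)}" by blast
  qed
qed (simp add: finite_bounded_mindices)

lemma mle_add_diff: "\<beta> \<lless> \<alpha> \<Longrightarrow> \<beta> + (\<alpha> - \<beta>) = \<alpha>"
  by (intro poly_mapping_eqI) (simp add: lookup_add lookup_minus mle_def)

lemma msize_diff:
  assumes "\<beta> \<lless> \<alpha>"
  shows "msize \<beta> + msize (\<alpha> - \<beta>) = msize \<alpha>"
  using assms mle_keys[OF assms] keys_mindex_diff[of \<alpha> \<beta>]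
  by (simp add: msize_superset[of "keys \<alpha>"] lookup_minus mle_def flip: sum.distrib)

text \<open>
  The identity that makes $\odot$ a convolution; it includes the exactness of the
  integer division in \<open>mbinom\<close>.
\<close>

lemma mbinom_mult:
  assumes "\<beta> \<lless> \<alpha>"
  shows "mbinom \<alpha> \<beta> * (mfact \<beta> * mfact (\<alpha> - \<beta>)) = mfact \<alpha>"
proof -
  have "mfact \<beta> * mfact (\<alpha> - \<beta>) dvd mfact \<alpha>"
    using assms mle_keys[OF assms] keys_mindex_diff[of \<alpha> \<beta>]
    by (simp add: mfact_superset[of "keys \<alpha>"] lookup_minus mle_def flip: prod.distrib)
       (rule prod_dvd_prod, metis fact_fact_dvd_fact le_add_diff_inverse)
  then show ?thesis unfolding mbinom_def by simp
qed

lemma mle_mindices: "\<beta> \<lless> \<alpha> \<Longrightarrow> \<alpha> \<in> mindices n \<Longrightarrow> \<beta> \<in> mindices n"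
  unfolding mindices_def using mle_keys by blast

lemma mindices_diff: "\<alpha> \<in> mindices n \<Longrightarrow> \<alpha> - \<beta> \<in> mindices n"
  unfolding mindices_def using keys_mindex_diff by blast

lemma mindices_add: "\<alpha> \<in> mindices n \<Longrightarrow> \<beta> \<in> mindices n \<Longrightarrow> \<alpha> + \<beta> \<in> mindices n"
  unfolding mindices_def using keys_add[of \<alpha> \<beta>] by auto

lemma munit_mle: "munit i \<lless> \<alpha> \<longleftrightarrow> i \<in> keys \<alpha>"
  unfolding mle_def munit_def by (auto simp: in_keys_iff lookup_single when_def)

lemma munit_eq_iff: "munit i = munit j \<longleftrightarrow> i = j"
  unfolding munit_def by (metis One_nat_def lookup_single_eq lookup_single_not_eq zero_neq_one)

lemma msize_munit: "msize (munit i) = 1"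
  unfolding munit_def msize_def by simp

lemma munit_in_mindices: "munit i \<in> mindices n \<longleftrightarrow> i < n"
  unfolding munit_def mindices_def by simp

text \<open>
  With the corresponding rule \<open>power_product_munit_diff\<close> below, this is the step from $m$ to
  $m+1$ in the multinomial expansion of a power.
\<close>

lemma mfact_munit_diff:
  assumes "i \<in> keys \<alpha>"
  shows "mfact \<alpha> = lookup \<alpha> i * mfact (\<alpha> - munit i)"
proof -
  have "(\<Prod>j\<in>keys \<alpha> - {i}. fact (lookup (\<alpha> - munit i) j)) = (\<Prod>j\<in>keys \<alpha> - {i}. (fact (lookup \<alpha> j) :: nat))"
    by (intro prod.cong) (auto simp: lookup_minus munit_def lookup_single)
  moreover have "fact (lookup \<alpha> i) = lookup \<alpha> i * fact (lookup (\<alpha> - munit i) i)"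
    using assms by (simp add: lookup_minus munit_def in_keys_iff fact_reduce)
  ultimately show ?thesis
    using assms keys_mindex_diff[of \<alpha> "munit i"]
    by (simp add: mfact_superset[of "keys \<alpha>"] prod.remove[of "keys \<alpha>" i])
qed

text \<open>
  The convolution of polynomials in the same index form as $\odot$, a finite sum over
  $\beta \ll \alpha$.
\<close>

lemma lookup_mult_mle:
  fixes f g :: "'a::comm_ring_1 mpoly"
  shows "lookup (f * g) \<alpha> = (\<Sum>\<beta> | \<beta> \<lless> \<alpha>. lookup f \<beta> * lookup g (\<alpha> - \<beta>))"
proof -
  have inner: "Sum_any (\<lambda>\<gamma>. lookup g \<gamma> when \<alpha> = \<beta> + \<gamma>) = (if \<beta> \<lless> \<alpha> then lookup g (\<alpha> - \<beta>) else 0)" for \<beta>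
  proof -
    have "\<alpha> = \<beta> + \<gamma> \<longleftrightarrow> \<beta> \<lless> \<alpha> \<and> \<gamma> = \<alpha> - \<beta>" for \<gamma>
      using mle_add_diff[of \<beta> \<alpha>] by (auto simp: mle_def lookup_add)
    then have "(\<lambda>\<gamma>. lookup g \<gamma> when \<alpha> = \<beta> + \<gamma>) = (\<lambda>\<gamma>. (lookup g \<gamma> when \<beta> \<lless> \<alpha>) when \<gamma> = \<alpha> - \<beta>)"
      by (auto simp: when_def)
    then show ?thesis by (simp only: Sum_any_when_equal) (simp add: when_def)
  qed
  have "lookup (f * g) \<alpha> = Sum_any (\<lambda>\<beta>. lookup f \<beta> * (if \<beta> \<lless> \<alpha> then lookup g (\<alpha> - \<beta>) else 0))"
    unfolding lookup_mult inner ..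
  also have "\<dots> = (\<Sum>\<beta> | \<beta> \<lless> \<alpha>. lookup f \<beta> * (if \<beta> \<lless> \<alpha> then lookup g (\<alpha> - \<beta>) else 0))"
    by (rule Sum_any.expand_superset[OF finite_mle]) auto
  finally show ?thesis by simp
qed

lemma lookup_mconst_mult: "lookup (mconst c * f) \<alpha> = c * lookup (f :: 'a::comm_ring_1 mpoly) \<alpha>"
proof -
  have "lookup (mconst c * f) \<alpha> = (\<Sum>\<beta>\<in>{0}. lookup (mconst c) \<beta> * lookup f (\<alpha> - \<beta>))"
    unfolding lookup_mult_mle
    by (rule sum.mono_neutral_right[OF finite_mle])
       (auto simp: mle_def mconst_def lookup_single when_def)
  then show ?thesis by (simp add: mconst_def)
qed

section \<open>Power products\<close>

definition power_product :: "(nat \<Rightarrow> 'a::comm_monoid_mult) \<Rightarrow> mindex \<Rightarrow> 'a" where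
  "power_product \<psi> \<gamma> = (\<Prod>i\<in>keys \<gamma>. \<psi> i ^ lookup \<gamma> i)"

lemma power_product_0: "power_product \<psi> 0 = 1"
  by (simp add: power_product_def)

lemma power_product_superset:
  assumes "finite K" "keys \<gamma> \<subseteq> K"
  shows "power_product \<psi> \<gamma> = (\<Prod>i\<in>K. \<psi> i ^ lookup \<gamma> i)"
  unfolding power_product_def using assms
  by (intro prod.mono_neutral_left) (auto simp: in_keys_iff)

lemma power_product_munit_diff:
  assumes "i \<in> keys \<gamma>"
  shows "\<psi> i * power_product \<psi> (\<gamma> - munit i) = power_product \<psi> \<gamma>"
proof -
  have "(\<Prod>j\<in>keys \<gamma> - {i}. \<psi> j ^ lookup (\<gamma> - munit i) j) = (\<Prod>j\<in>keys \<gamma> - {i}. \<psi> j ^ lookup \<gamma> j)"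
    by (intro prod.cong) (auto simp: lookup_minus munit_def lookup_single)
  moreover have "\<psi> i * \<psi> i ^ lookup (\<gamma> - munit i) i = \<psi> i ^ lookup \<gamma> i"
    using assms by (simp add: lookup_minus munit_def in_keys_iff flip: power_Suc)
  ultimately show ?thesis
    using assms keys_mindex_diff[of \<gamma> "munit i"]
    by (simp add: power_product_superset[of "keys \<gamma>"] prod.remove[of "keys \<gamma>" i] flip: mult.assoc)
qed


section \<open>Products of block matrices\<close>

lemma bmats_zero:
  assumes "A \<in> bmats n n'" "\<not> (\<alpha> \<in> mindices_of_size n p \<and> \<alpha>' \<in> mindices_of_size n' p')"
  shows "A p p' \<alpha> \<alpha>' = 0"
  using assms unfolding bmats_def blocks_def by blast

text \<open>
  The sums over block sizes in \<open>odot\<close> are only bookkeeping: the size of a block is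
  determined by the multiindices that occur in it.
\<close>

lemma sum_mle_by_size:
  assumes "\<alpha> \<in> mindices_of_size n p"
  shows "(\<Sum>q\<le>p. \<Sum>\<beta> | \<beta> \<in> mindices_of_size n q \<and> \<beta> \<lless> \<alpha>. f q \<beta>) =
    (\<Sum>\<beta> | \<beta> \<lless> \<alpha>. f (msize \<beta>) \<beta>)"
proof -
  have "\<beta> \<in> mindices_of_size n q \<longleftrightarrow> msize \<beta> = q" if "\<beta> \<lless> \<alpha>" for \<beta> q
    using assms mle_mindices[OF that] by (auto simp: mindices_of_size_def)
  then have "{\<beta>. \<beta> \<in> mindices_of_size n q \<and> \<beta> \<lless> \<alpha>} = {\<beta> \<in> {\<beta>. \<beta> \<lless> \<alpha>}. msize \<beta> = q}" for q
    by blast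
  then have "(\<Sum>q\<le>p. \<Sum>\<beta> | \<beta> \<in> mindices_of_size n q \<and> \<beta> \<lless> \<alpha>. f q \<beta>) =
      (\<Sum>q\<le>p. \<Sum>\<beta> | \<beta> \<in> {\<beta>. \<beta> \<lless> \<alpha>} \<and> msize \<beta> = q. f (msize \<beta>) \<beta>)"
    by simp
  also have "\<dots> = (\<Sum>\<beta> | \<beta> \<lless> \<alpha>. f (msize \<beta>) \<beta>)"
  proof (rule sum.group)
    show "msize ` {\<beta>. \<beta> \<lless> \<alpha>} \<subseteq> {..p}"
      using assms msize_diff[of _ \<alpha>] by (force simp: mindices_of_size_def)
  qed (simp_all add: finite_mle)
  finally show ?thesis .
qed

lemma mindices_of_size_add:
  assumes "\<beta> \<in> mindices_of_size n q" "\<beta> \<lless> \<alpha>" "q \<le> p" "\<alpha> - \<beta> \<in> mindices_of_size n (p - q)"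
  shows "\<alpha> \<in> mindices_of_size n p"
  using assms msize_diff[OF assms(2)] mindices_add[of \<beta> n "\<alpha> - \<beta>"]
  by (auto simp: mindices_of_size_def mle_add_diff)

lemma odot_in_bmats:
  assumes "B \<in> bmats n n'"
  shows "odot n n' A B \<in> bmats n n'"
proof -
  have "odot n n' A B p p' \<alpha> \<alpha>' = 0"
    if "\<not> (\<alpha> \<in> mindices_of_size n p \<and> \<alpha>' \<in> mindices_of_size n' p')" for p p' \<alpha> \<alpha>'
    unfolding odot_def block_odot_def
  proof (intro sum.neutral ballI)
    fix q q' \<beta> \<beta>'
    assume *: "q \<in> {..p}" "\<beta> \<in> {\<beta>. \<beta> \<in> mindices_of_size n q \<and> \<beta> \<lless> \<alpha>}"
      "q' \<in> {..p'}" "\<beta>' \<in> {\<beta>'. \<beta>' \<in> mindices_of_size n' q' \<and> \<beta>' \<lless> \<alpha>'}"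
    have "B (p - q) (p' - q') (\<alpha> - \<beta>) (\<alpha>' - \<beta>') = 0"
    proof (rule bmats_zero[OF assms], rule notI, elim conjE)
      assume "\<alpha> - \<beta> \<in> mindices_of_size n (p - q)" "\<alpha>' - \<beta>' \<in> mindices_of_size n' (p' - q')"
      then have "\<alpha> \<in> mindices_of_size n p" "\<alpha>' \<in> mindices_of_size n' p'"
        using * by (auto intro: mindices_of_size_add)
      then show False using that by blast
    qed
    then show "of_nat (mbinom \<alpha> \<beta>) * A q q' \<beta> \<beta>' * B (p - q) (p' - q') (\<alpha> - \<beta>) (\<alpha>' - \<beta>') = 0"
      by simp
  qed
  then show ?thesis unfolding bmats_def blocks_def by blast
qed

lemma odot_entry:
  assumes "\<alpha> \<in> mindices_of_size n p" "\<alpha>' \<in> mindices_of_size n' p'"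
  shows "odot n n' A B p p' \<alpha> \<alpha>' = (\<Sum>\<beta> | \<beta> \<lless> \<alpha>. \<Sum>\<beta>' | \<beta>' \<lless> \<alpha>'.
    of_nat (mbinom \<alpha> \<beta>) * A (msize \<beta>) (msize \<beta>') \<beta> \<beta>' *
      B (msize (\<alpha> - \<beta>)) (msize (\<alpha>' - \<beta>')) (\<alpha> - \<beta>) (\<alpha>' - \<beta>'))"
proof -
  have p: "p = msize \<alpha>" and p': "p' = msize \<alpha>'"
    using assms by (auto simp: mindices_of_size_def)
  have "odot n n' A B p p' \<alpha> \<alpha>' =
    (\<Sum>q\<le>p. \<Sum>\<beta> | \<beta> \<in> mindices_of_size n q \<and> \<beta> \<lless> \<alpha>.
     \<Sum>q'\<le>p'. \<Sum>\<beta>' | \<beta>' \<in> mindices_of_size n' q' \<and> \<beta>' \<lless> \<alpha>'.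
       of_nat (mbinom \<alpha> \<beta>) * A q q' \<beta> \<beta>' * B (p - q) (p' - q') (\<alpha> - \<beta>) (\<alpha>' - \<beta>'))"
    unfolding odot_def block_odot_def by (intro sum.cong refl sum.swap)
  also have "\<dots> = (\<Sum>\<beta> | \<beta> \<lless> \<alpha>. \<Sum>\<beta>' | \<beta>' \<lless> \<alpha>'.
       of_nat (mbinom \<alpha> \<beta>) * A (msize \<beta>) (msize \<beta>') \<beta> \<beta>' *
         B (p - msize \<beta>) (p' - msize \<beta>') (\<alpha> - \<beta>) (\<alpha>' - \<beta>'))"
    unfolding sum_mle_by_size[OF assms(1)] sum_mle_by_size[OF assms(2)] ..
  also have "\<dots> = (\<Sum>\<beta> | \<beta> \<lless> \<alpha>. \<Sum>\<beta>' | \<beta>' \<lless> \<alpha>'.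
       of_nat (mbinom \<alpha> \<beta>) * A (msize \<beta>) (msize \<beta>') \<beta> \<beta>' *
         B (msize (\<alpha> - \<beta>)) (msize (\<alpha>' - \<beta>')) (\<alpha> - \<beta>) (\<alpha>' - \<beta>'))"
  proof (intro sum.cong refl)
    fix \<beta> \<beta>' assume "\<beta> \<in> {\<beta>. \<beta> \<lless> \<alpha>}" "\<beta>' \<in> {\<beta>'. \<beta>' \<lless> \<alpha>'}"
    then have "p - msize \<beta> = msize (\<alpha> - \<beta>)" "p' - msize \<beta>' = msize (\<alpha>' - \<beta>')"
      using msize_diff[of \<beta> \<alpha>] msize_diff[of \<beta>' \<alpha>'] by (simp_all add: p p')
    then show "of_nat (mbinom \<alpha> \<beta>) * A (msize \<beta>) (msize \<beta>') \<beta> \<beta>' *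
         B (p - msize \<beta>) (p' - msize \<beta>') (\<alpha> - \<beta>) (\<alpha>' - \<beta>') =
        of_nat (mbinom \<alpha> \<beta>) * A (msize \<beta>) (msize \<beta>') \<beta> \<beta>' *
         B (msize (\<alpha> - \<beta>)) (msize (\<alpha>' - \<beta>')) (\<alpha> - \<beta>) (\<alpha>' - \<beta>')" by simp
  qed
  finally show ?thesis .
qed

text \<open>
  The formal infinite sum over the inner block size is harmless as soon as only finitely many
  rows of \<open>B\<close> meet the column in question; it then becomes a sum over the multiindices themselves.
\<close>

lemma bmat_mult_entry:
  assumes "finite S" "S \<subseteq> mindices n"
    and "\<And>\<beta>. \<beta> \<in> mindices n \<Longrightarrow> B (msize \<beta>) p' \<beta> \<alpha>' \<noteq> 0 \<Longrightarrow> \<beta> \<in> S"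
  shows "bmat_mult n A B p p' \<alpha> \<alpha>' = (\<Sum>\<beta>\<in>S. A p (msize \<beta>) \<alpha> \<beta> * B (msize \<beta>) p' \<beta> \<alpha>')"
proof -
  have inner: "(\<Sum>\<beta>\<in>mindices_of_size n q. A p q \<alpha> \<beta> * B q p' \<beta> \<alpha>') =
      (\<Sum>\<beta> | \<beta> \<in> S \<and> msize \<beta> = q. A p (msize \<beta>) \<alpha> \<beta> * B (msize \<beta>) p' \<beta> \<alpha>')" for q
  proof -
    have "(\<Sum>\<beta>\<in>mindices_of_size n q. A p q \<alpha> \<beta> * B q p' \<beta> \<alpha>') =
        (\<Sum>\<beta> | \<beta> \<in> S \<and> msize \<beta> = q. A p q \<alpha> \<beta> * B q p' \<beta> \<alpha>')"
    proof (rule sum.mono_neutral_right[OF finite_mindices_of_size])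
      show "\<forall>\<beta>\<in>mindices_of_size n q - {\<beta> \<in> S. msize \<beta> = q}. A p q \<alpha> \<beta> * B q p' \<beta> \<alpha>' = 0"
        using assms(3) by (auto simp: mindices_of_size_def) (metis mult_zero_right)
    qed (use assms(2) in \<open>auto simp: mindices_of_size_def\<close>)
    then show ?thesis by (simp cong: sum.cong_simp)
  qed
  have "bmat_mult n A B p p' \<alpha> \<alpha>' =
      Sum_any (\<lambda>q. \<Sum>\<beta> | \<beta> \<in> S \<and> msize \<beta> = q. A p (msize \<beta>) \<alpha> \<beta> * B (msize \<beta>) p' \<beta> \<alpha>')"
    unfolding bmat_mult_def inner ..
  also have "\<dots> = (\<Sum>q\<in>msize ` S. \<Sum>\<beta> | \<beta> \<in> S \<and> msize \<beta> = q. A p (msize \<beta>) \<alpha> \<beta> * B (msize \<beta>) p' \<beta> \<alpha>')"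
  proof (rule Sum_any.expand_superset)
    show "{q. (\<Sum>\<beta> | \<beta> \<in> S \<and> msize \<beta> = q. A p (msize \<beta>) \<alpha> \<beta> * B (msize \<beta>) p' \<beta> \<alpha>') \<noteq> 0} \<subseteq> msize ` S"
      by (auto elim!: sum.not_neutral_contains_not_neutral)
  qed (use assms(1) in simp)
  also have "\<dots> = (\<Sum>\<beta>\<in>S. A p (msize \<beta>) \<alpha> \<beta> * B (msize \<beta>) p' \<beta> \<alpha>')"
    using assms(1) by (intro sum.group) auto
  finally show ?thesis .
qed

section \<open>Matrices of Taylor coefficients\<close>

text \<open>
  The sum has at most one nonzero term, as unit multiindices are distinct; it serves to pick the
  \<open>j\<close> with $\alpha' =$ \<open>munit j\<close>, and gives 0 when there is none.
\<close>

definition taylor_bmat :: "nat \<Rightarrow> nat \<Rightarrow> (nat \<Rightarrow> 'a::comm_ring_rat mpoly) \<Rightarrow> 'a bmat" where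
  "taylor_bmat n n' \<psi> = (\<lambda>p p' \<alpha> \<alpha>'. \<Sum>j<n'.
     if p' = 1 \<and> \<alpha>' = munit j \<and> \<alpha> \<in> mindices_of_size n p
     then of_nat (mfact \<alpha>) * lookup (\<psi> j) \<alpha> else 0)"

lemma taylor_bmat_munit:
  assumes "j < n'"
  shows "taylor_bmat n n' \<psi> p p' \<alpha> (munit j) =
    (if p' = 1 \<and> \<alpha> \<in> mindices_of_size n p then of_nat (mfact \<alpha>) * lookup (\<psi> j) \<alpha> else 0)"
proof -
  have "taylor_bmat n n' \<psi> p p' \<alpha> (munit j) = (\<Sum>i<n'. if i = j then 
     (if p' = 1 \<and> \<alpha> \<in> mindices_of_size n p then of_nat (mfact \<alpha>) * lookup (\<psi> j) \<alpha> else 0) else 0)"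
    unfolding taylor_bmat_def by (intro sum.cong) (auto simp: munit_eq_iff)
  then show ?thesis using assms by simp
qed

lemma taylor_bmat_zero:
  assumes "\<not> (\<exists>j<n'. \<alpha>' = munit j) \<or> p' \<noteq> 1 \<or> \<alpha> \<notin> mindices_of_size n p"
  shows "taylor_bmat n n' \<psi> p p' \<alpha> \<alpha>' = 0"
  unfolding taylor_bmat_def using assms by (intro sum.neutral) auto

lemma taylor_bmat_in_bmats: "taylor_bmat n n' \<psi> \<in> bmats n n'"
proof -
  have "\<alpha> \<in> mindices_of_size n p \<and> \<alpha>' \<in> mindices_of_size n' p'"
    if "taylor_bmat n n' \<psi> p p' \<alpha> \<alpha>' \<noteq> 0" for p p' \<alpha> \<alpha>'
  proof -
    have "p' = 1" "\<alpha> \<in> mindices_of_size n p" "\<exists>j<n'. \<alpha>' = munit j"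
      using that taylor_bmat_zero by metis+
    then show ?thesis by (auto simp: mindices_of_size_def munit_in_mindices msize_munit)
  qed
  then show ?thesis unfolding bmats_def blocks_def by blast
qed

text \<open>
  A row is the Taylor table of a constant map. This makes $\mathrm{Exp}(x)$ a case of
  \<open>Exp_taylor_bmat\<close>, with coefficient ring $R[x]$.
\<close>

lemma row_bmat_eq_taylor_bmat:
  "row_bmat n v = taylor_bmat n' n (\<lambda>j. mconst (v j))"
proof (intro ext)
  fix p p' and \<alpha> \<alpha>' :: mindex
  have *: "\<alpha> = 0 \<and> p = 0 \<longleftrightarrow> \<alpha> = 0 \<and> \<alpha> \<in> mindices_of_size n' p"
    by (auto simp: mindices_of_size_def mindices_def msize_def)
  have "mfact (0::mindex) = 1" by (simp add: mfact_def)
  then show "row_bmat n v p p' \<alpha> \<alpha>' = taylor_bmat n' n (\<lambda>j. mconst (v j)) p p' \<alpha> \<alpha>'"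
    unfolding row_bmat_def taylor_bmat_def mconst_def using *
    by (intro sum.cong refl) (auto simp: lookup_single when_def)
qed

lemma odot_power_in_bmats: "odot_power n n' A m \<in> bmats n n'"
proof (induction m)
  case 0
  show ?case
    by (auto simp: odot_one_def bmats_def blocks_def mindices_of_size_def mindices_def msize_def
        split: if_splits)
next
  case (Suc m)
  then show ?case by (simp add: odot_in_bmats)
qed

text \<open>
  The $m$-th $\odot$-power collects all products of $m$ components of $\psi$; the column
  $\alpha'$ gets $\psi^{\alpha'}$ once for each of the $m!/\alpha'!$ orderings of the factors,
  as in the multinomial theorem. In the induction step, the left factor contributes one component
  $\psi_i$, and $\sum_i \alpha'_i = |\alpha'| = m+1$ counts the choices of $i$.
\<close>

lemma odot_power_taylor_bmat:
  assumes "\<alpha> \<in> mindices_of_size n p" "\<alpha>' \<in> mindices_of_size n' p'"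
  shows "odot_power n n' (taylor_bmat n n' \<psi>) m p p' \<alpha> \<alpha>' =
    (if p' = m then rat_emb (of_nat (mfact \<alpha> * fact m) / of_nat (mfact \<alpha>')) *
       lookup (power_product \<psi> \<alpha>') \<alpha> else 0)"
  using assms
proof (induction m arbitrary: p p' \<alpha> \<alpha>')
  case 0
  have "\<alpha>' = 0 \<longleftrightarrow> p' = 0"
  proof
    assume "p' = 0"
    then have "lookup \<alpha>' i = 0" for i
      using 0(2) by (cases "i \<in> keys \<alpha>'") (auto simp: mindices_of_size_def msize_def in_keys_iff)
    then show "\<alpha>' = 0" by (intro poly_mapping_eqI) simp
  qed (use 0 in \<open>auto simp: mindices_of_size_def msize_def\<close>)
  moreover have "\<alpha> = 0 \<Longrightarrow> p = 0"
    using 0 by (simp add: mindices_of_size_def msize_def)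
  ultimately show ?case
    by (auto simp: odot_one_def power_product_0 lookup_one when_def mfact_def rat_emb_1)
next
  case (Suc m)
  let ?T = "taylor_bmat n n' \<psi>" and ?P = "odot_power n n' (taylor_bmat n n' \<psi>) m"
  let ?c = "of_nat (mfact \<alpha> * fact m) / of_nat (mfact \<alpha>') :: rat"
  have \<alpha>: "\<alpha> \<in> mindices n" "msize \<alpha> = p" and \<alpha>': "\<alpha>' \<in> mindices n'" "msize \<alpha>' = p'"
    using Suc.prems by (auto simp: mindices_of_size_def)
  have keys_lt: "i < n'" if "i \<in> keys \<alpha>'" for i
    using that \<alpha>'(1) by (auto simp: mindices_def)
  \<comment> \<open>For a fixed row \<open>\<beta>\<close> of the left factor, only the columns \<open>munit i\<close> contribute. The
    factorials are merged here, so that what remains is convolution.\<close>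
  have row: "(\<Sum>\<beta>' | \<beta>' \<lless> \<alpha>'. of_nat (mbinom \<alpha> \<beta>) * ?T (msize \<beta>) (msize \<beta>') \<beta> \<beta>' *
        ?P (msize (\<alpha> - \<beta>)) (msize (\<alpha>' - \<beta>')) (\<alpha> - \<beta>) (\<alpha>' - \<beta>')) =
      (if p' = Suc m then \<Sum>i\<in>keys \<alpha>'. rat_emb (?c * of_nat (lookup \<alpha>' i)) *
        (lookup (\<psi> i) \<beta> * lookup (power_product \<psi> (\<alpha>' - munit i)) (\<alpha> - \<beta>)) else 0)"
    (is "?lhs = ?rhs") if \<beta>: "\<beta> \<lless> \<alpha>" for \<beta>
  proof -
    have "?lhs = (\<Sum>\<beta>'\<in>munit ` keys \<alpha>'. of_nat (mbinom \<alpha> \<beta>) * ?T (msize \<beta>) (msize \<beta>') \<beta> \<beta>' *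
        ?P (msize (\<alpha> - \<beta>)) (msize (\<alpha>' - \<beta>')) (\<alpha> - \<beta>) (\<alpha>' - \<beta>'))"
    proof (rule sum.mono_neutral_right[OF finite_mle])
      show "munit ` keys \<alpha>' \<subseteq> {\<beta>'. \<beta>' \<lless> \<alpha>'}" by (auto simp: munit_mle)
      show "\<forall>\<beta>'\<in>{\<beta>'. \<beta>' \<lless> \<alpha>'} - munit ` keys \<alpha>'. of_nat (mbinom \<alpha> \<beta>) * ?T (msize \<beta>) (msize \<beta>') \<beta> \<beta>' *
        ?P (msize (\<alpha> - \<beta>)) (msize (\<alpha>' - \<beta>')) (\<alpha> - \<beta>) (\<alpha>' - \<beta>') = 0"
      proof
        fix \<beta>' assume "\<beta>' \<in> {\<beta>'. \<beta>' \<lless> \<alpha>'} - munit ` keys \<alpha>'"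
        then have "\<not> (\<exists>j<n'. \<beta>' = munit j)" by (auto simp: munit_mle)
        then show "of_nat (mbinom \<alpha> \<beta>) * ?T (msize \<beta>) (msize \<beta>') \<beta> \<beta>' *
        ?P (msize (\<alpha> - \<beta>)) (msize (\<alpha>' - \<beta>')) (\<alpha> - \<beta>) (\<alpha>' - \<beta>') = 0"
          by (simp add: taylor_bmat_zero)
      qed
    qed
    also have "\<dots> = (\<Sum>i\<in>keys \<alpha>'. of_nat (mbinom \<alpha> \<beta>) * ?T (msize \<beta>) 1 \<beta> (munit i) *
        ?P (msize (\<alpha> - \<beta>)) (msize (\<alpha>' - munit i)) (\<alpha> - \<beta>) (\<alpha>' - munit i))"
      by (subst sum.reindex) (auto simp: inj_on_def munit_eq_iff msize_munit)
    also have "\<dots> = (\<Sum>i\<in>keys \<alpha>'. if p' = Suc m then rat_emb (?c * of_nat (lookup \<alpha>' i)) *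
        (lookup (\<psi> i) \<beta> * lookup (power_product \<psi> (\<alpha>' - munit i)) (\<alpha> - \<beta>)) else 0)"
    proof (rule sum.cong[OF refl])
      fix i assume i: "i \<in> keys \<alpha>'"
      have T: "?T (msize \<beta>) 1 \<beta> (munit i) = of_nat (mfact \<beta>) * lookup (\<psi> i) \<beta>"
        using keys_lt[OF i] mle_mindices[OF \<beta> \<alpha>(1)]
        by (simp add: taylor_bmat_munit mindices_of_size_def)
      have size: "msize (\<alpha>' - munit i) = m \<longleftrightarrow> p' = Suc m"
        using msize_diff[of "munit i" \<alpha>'] i \<alpha>'(2) by (auto simp: munit_mle msize_munit)
      have P: "?P (msize (\<alpha> - \<beta>)) (msize (\<alpha>' - munit i)) (\<alpha> - \<beta>) (\<alpha>' - munit i) =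
          (if p' = Suc m then rat_emb (of_nat (mfact (\<alpha> - \<beta>) * fact m) / of_nat (mfact (\<alpha>' - munit i))) *
             lookup (power_product \<psi> (\<alpha>' - munit i)) (\<alpha> - \<beta>) else 0)"
        unfolding size[symmetric]
        by (rule Suc.IH) (simp_all add: mindices_of_size_def mindices_diff \<alpha> \<alpha>')
      have "(of_nat (mbinom \<alpha> \<beta>) * of_nat (mfact \<beta>)) *
          (of_nat (mfact (\<alpha> - \<beta>) * fact m) / of_nat (mfact (\<alpha>' - munit i))) = ?c * of_nat (lookup \<alpha>' i)"
      proof -
        have "lookup \<alpha>' i > 0" using i by (simp add: in_keys_iff)
        then show ?thesis
          unfolding mbinom_mult[OF \<beta>, symmetric] mfact_munit_diff[OF i]
          using mfact_pos[of "\<alpha>' - munit i"] by (simp add: field_simps)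
      qed
      then have c: "of_nat (mbinom \<alpha> \<beta>) * of_nat (mfact \<beta>) *
          rat_emb (of_nat (mfact (\<alpha> - \<beta>) * fact m) / of_nat (mfact (\<alpha>' - munit i))) =
          (rat_emb (?c * of_nat (lookup \<alpha>' i)) :: 'a)"
        by (simp only: rat_emb_mult rat_emb_of_nat flip: \<open>_ = ?c * of_nat (lookup \<alpha>' i)\<close>)
      show "of_nat (mbinom \<alpha> \<beta>) * ?T (msize \<beta>) 1 \<beta> (munit i) *
          ?P (msize (\<alpha> - \<beta>)) (msize (\<alpha>' - munit i)) (\<alpha> - \<beta>) (\<alpha>' - munit i) =
          (if p' = Suc m then rat_emb (?c * of_nat (lookup \<alpha>' i)) *
            (lookup (\<psi> i) \<beta> * lookup (power_product \<psi> (\<alpha>' - munit i)) (\<alpha> - \<beta>)) else 0)"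
        unfolding T P c[symmetric] by (simp add: ac_simps)
    qed
    also have "\<dots> = ?rhs" by simp
    finally show ?thesis .
  qed
  have "odot_power n n' ?T (Suc m) p p' \<alpha> \<alpha>' =
    (\<Sum>\<beta> | \<beta> \<lless> \<alpha>. if p' = Suc m then \<Sum>i\<in>keys \<alpha>'. rat_emb (?c * of_nat (lookup \<alpha>' i)) *
        (lookup (\<psi> i) \<beta> * lookup (power_product \<psi> (\<alpha>' - munit i)) (\<alpha> - \<beta>)) else 0)"
    unfolding odot_power.simps odot_entry[OF Suc.prems] by (intro sum.cong refl row) simp
  also have "\<dots> = (if p' = Suc m then rat_emb (of_nat (mfact \<alpha> * fact (Suc m)) / of_nat (mfact \<alpha>')) *
       lookup (power_product \<psi> \<alpha>') \<alpha> else 0)"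
  proof (cases "p' = Suc m")
    case True
    have "(\<Sum>\<beta> | \<beta> \<lless> \<alpha>. \<Sum>i\<in>keys \<alpha>'. rat_emb (?c * of_nat (lookup \<alpha>' i)) *
        (lookup (\<psi> i) \<beta> * lookup (power_product \<psi> (\<alpha>' - munit i)) (\<alpha> - \<beta>))) =
      (\<Sum>i\<in>keys \<alpha>'. rat_emb (?c * of_nat (lookup \<alpha>' i)) *
        lookup (\<psi> i * power_product \<psi> (\<alpha>' - munit i)) \<alpha>)"
      unfolding lookup_mult_mle by (subst sum.swap) (simp add: sum_distrib_left)
    also have "\<dots> = (\<Sum>i\<in>keys \<alpha>'. rat_emb ?c * of_nat (lookup \<alpha>' i) * lookup (power_product \<psi> \<alpha>') \<alpha>)"
      by (intro sum.cong refl) (simp only: power_product_munit_diff rat_emb_mult rat_emb_of_nat)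
    also have "\<dots> = rat_emb ?c * of_nat (msize \<alpha>') * lookup (power_product \<psi> \<alpha>') \<alpha>"
      by (simp add: msize_def sum_distrib_left sum_distrib_right)
    also have "rat_emb ?c * of_nat (msize \<alpha>') = (rat_emb (?c * of_nat (Suc m)) :: 'a)"
      using \<alpha>'(2) True by (simp only: rat_emb_mult rat_emb_of_nat)
    also have "?c * of_nat (Suc m) = of_nat (mfact \<alpha> * fact (Suc m)) / of_nat (mfact \<alpha>')"
      by (simp add: algebra_simps add_divide_distrib)
    finally show ?thesis using True by simp
  qed simp
  finally show ?case .
qed

text \<open>
  The column $\alpha'$ receives a contribution only from the power $|\alpha'|$, so the exponential
  series is a finite sum in each entry, for every $\psi$; its factor $1/m!$ turns the
  multinomial coefficient into $1/\alpha'!$.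
\<close>

lemma Exp_taylor_bmat:
  "Exp n n' (taylor_bmat n n' \<psi>) p p' \<alpha> \<alpha>' =
    (if \<alpha> \<in> mindices_of_size n p \<and> \<alpha>' \<in> mindices_of_size n' p'
     then rat_emb (of_nat (mfact \<alpha>) / of_nat (mfact \<alpha>')) * lookup (power_product \<psi> \<alpha>') \<alpha> else 0)"
proof (cases "\<alpha> \<in> mindices_of_size n p \<and> \<alpha>' \<in> mindices_of_size n' p'")
  case True
  then have "Exp n n' (taylor_bmat n n' \<psi>) p p' \<alpha> \<alpha>' =
      Sum_any (\<lambda>i. rat_emb (1 / fact p') * odot_power n n' (taylor_bmat n n' \<psi>) p' p p' \<alpha> \<alpha>' when i = p')"
    unfolding Exp_def by (intro Sum_any.cong) (auto simp: odot_power_taylor_bmat)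
  also have "\<dots> = rat_emb (1 / fact p') * odot_power n n' (taylor_bmat n n' \<psi>) p' p p' \<alpha> \<alpha>'"
    by (rule Sum_any_when_equal)
  also have "\<dots> = rat_emb (1 / fact p' * (of_nat (mfact \<alpha> * fact p') / of_nat (mfact \<alpha>'))) *
      lookup (power_product \<psi> \<alpha>') \<alpha>"
    using True by (simp only: odot_power_taylor_bmat simp_thms if_True rat_emb_mult mult.assoc)
  also have "1 / fact p' * (of_nat (mfact \<alpha> * fact p') / of_nat (mfact \<alpha>')) =
      (of_nat (mfact \<alpha>) / of_nat (mfact \<alpha>') :: rat)"
    by simp
  finally show ?thesis using True by simp
next
  case False
  then show ?thesis
    unfolding Exp_def by (simp add: bmats_zero[OF odot_power_in_bmats] del: de_Morgan_conj)
qed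

lemma mconst_mult: "mconst (a * b) = (mconst a * mconst b :: 'a::comm_ring_1 mpoly)"
  by (simp add: mconst_def mult_single)

lemma mconst_power_product:
  "power_product (\<lambda>j. mconst (v j)) \<gamma> = mconst (power_product v \<gamma> :: 'a::comm_ring_1)"
proof -
  have 1: "mconst 1 = (1 :: 'a mpoly)" by (simp add: mconst_def)
  have power: "mconst a ^ k = mconst (a ^ k)" for a :: 'a and k
    by (induction k) (simp_all add: 1 mconst_mult)
  have "(\<Prod>i\<in>K. mconst (f i)) = mconst (prod f K)" for f :: "nat \<Rightarrow> 'a" and K
    by (induction K rule: infinite_finite_induct) (simp_all add: 1 mconst_mult)
  then show ?thesis unfolding power_product_def power .
qed

lemma power_product_mvar: "power_product mvar \<gamma> = (Poly_Mapping.single \<gamma> 1 :: 'a::comm_ring_1 mpoly)"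
proof -
  have power: "mvar i ^ k = (Poly_Mapping.single (Poly_Mapping.single i k) 1 :: 'a mpoly)" for i k
    by (induction k) (simp_all add: mvar_def munit_def mult_single flip: single_add)
  have prod: "(\<Prod>i\<in>K. Poly_Mapping.single (f i) 1) = (Poly_Mapping.single (sum f K) 1 :: 'a mpoly)"
    if "finite K" for f :: "nat \<Rightarrow> mindex" and K
    using that by induction (simp_all add: mult_single)
  have "(\<Sum>i\<in>keys \<gamma>. Poly_Mapping.single i (lookup \<gamma> i)) = \<gamma>"
    by (rule poly_mapping_eqI) (simp add: lookup_sum lookup_single when_def in_keys_iff)
  then show ?thesis unfolding power_product_def power by (simp add: prod)
qed

lemma Exp_row_mvar:
  "Exp n n (row_bmat n mvar) p p' \<alpha> \<alpha>' =
    (if p = 0 \<and> \<alpha> = 0 \<and> \<alpha>' \<in> mindices_of_size n p'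
     then Poly_Mapping.single \<alpha>' (rat_emb (1 / of_nat (mfact \<alpha>'))) else (0 :: 'a::comm_ring_rat mpoly))"
proof -
  have 0: "mfact (0::mindex) = 1" by (simp add: mfact_def)
  have size: "0 \<in> mindices_of_size n p \<longleftrightarrow> p = 0"
    by (auto simp: mindices_of_size_def mindices_def msize_def)
  show ?thesis
    unfolding row_bmat_eq_taylor_bmat[of n mvar n] Exp_taylor_bmat mconst_power_product power_product_mvar
    by (cases "\<alpha> = 0")
       (auto simp: size 0 mconst_def lookup_single rat_emb_inverse_mpoly mfact_pos mult_single)
qed

section \<open>The matrix of a polynomial map\<close>

lemma finitely_many_rows:
  assumes "finite {p. M p 1 \<noteq> (\<lambda>\<alpha> \<alpha>'. 0)}"
  obtains S where "finite S" "S \<subseteq> mindices n"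
    "\<And>\<beta> \<alpha>'. \<beta> \<in> mindices n \<Longrightarrow> M (msize \<beta>) 1 \<beta> \<alpha>' \<noteq> 0 \<Longrightarrow> \<beta> \<in> S"
proof
  let ?S = "\<Union>p\<in>{p. M p 1 \<noteq> (\<lambda>\<alpha> \<alpha>'. 0)}. mindices_of_size n p"
  show "finite ?S" using assms by (auto simp: finite_mindices_of_size)
  show "?S \<subseteq> mindices n" by (auto simp: mindices_of_size_def)
  show "\<beta> \<in> ?S" if "\<beta> \<in> mindices n" "M (msize \<beta>) 1 \<beta> \<alpha>' \<noteq> 0" for \<beta> \<alpha>'
    using that by (force simp: mindices_of_size_def)
qed

text \<open>
  Multiplication by $\mathrm{Exp}(x)$ only divides the row $\gamma$ of $M$ by $\gamma!$ and moves
  it to the coefficient of $x^\gamma$. This gives both existence and uniqueness of the matrix of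
  a map: the rows of $M$ can be recovered from $\mathrm{Exp}(x)M$, as $\gamma!$ is invertible.
\<close>

lemma lookup_Exp_row_mult:
  fixes M :: "'a::comm_ring_rat bmat"
  assumes "finite {p. M p 1 \<noteq> (\<lambda>\<alpha> \<alpha>'. 0)}"
  shows "lookup (bmat_mult n (Exp n n (row_bmat n mvar)) (\<lambda>p p' \<alpha> \<alpha>'. mconst (M p p' \<alpha> \<alpha>')) p 1 \<alpha> \<alpha>') \<gamma> =
    (if p = 0 \<and> \<alpha> = 0 \<and> \<gamma> \<in> mindices n
     then rat_emb (1 / of_nat (mfact \<gamma>)) * M (msize \<gamma>) 1 \<gamma> \<alpha>' else 0)"
proof -
  obtain S where S: "finite S" "S \<subseteq> mindices n"
    "\<And>\<beta> \<alpha>'. \<beta> \<in> mindices n \<Longrightarrow> M (msize \<beta>) 1 \<beta> \<alpha>' \<noteq> 0 \<Longrightarrow> \<beta> \<in> S"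
    using finitely_many_rows[where M=M and n=n, OF assms] by metis
  have mconst_neq: "M (msize \<beta>) 1 \<beta> \<alpha>' \<noteq> 0" if "(mconst (M (msize \<beta>) 1 \<beta> \<alpha>') :: 'a mpoly) \<noteq> 0" for \<beta>
    using that by (auto simp: mconst_def)
  have "bmat_mult n (Exp n n (row_bmat n mvar)) (\<lambda>p p' \<alpha> \<alpha>'. mconst (M p p' \<alpha> \<alpha>')) p 1 \<alpha> \<alpha>' =
    (\<Sum>\<beta>\<in>S. Exp n n (row_bmat n mvar) p (msize \<beta>) \<alpha> \<beta> * mconst (M (msize \<beta>) 1 \<beta> \<alpha>'))"
    by (rule bmat_mult_entry[OF S(1,2)]) (use mconst_neq S(3) in blast)
  also have "\<dots> = (\<Sum>\<beta>\<in>S. if p = 0 \<and> \<alpha> = 0 then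
      Poly_Mapping.single \<beta> (rat_emb (1 / of_nat (mfact \<beta>)) * M (msize \<beta>) 1 \<beta> \<alpha>') else 0)"
    using S(2) by (intro sum.cong refl)
      (auto simp: Exp_row_mvar mindices_of_size_def mconst_def mult_single)
  finally have "bmat_mult n (Exp n n (row_bmat n mvar)) (\<lambda>p p' \<alpha> \<alpha>'. mconst (M p p' \<alpha> \<alpha>')) p 1 \<alpha> \<alpha>' = \<dots>" .
  then have "lookup (bmat_mult n (Exp n n (row_bmat n mvar)) (\<lambda>p p' \<alpha> \<alpha>'. mconst (M p p' \<alpha> \<alpha>')) p 1 \<alpha> \<alpha>') \<gamma> =
    (\<Sum>\<beta>\<in>S. if \<beta> = \<gamma> then
      (if p = 0 \<and> \<alpha> = 0 then rat_emb (1 / of_nat (mfact \<gamma>)) * M (msize \<gamma>) 1 \<gamma> \<alpha>' else 0) else 0)"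
    by (simp only: lookup_sum) (intro sum.cong refl, simp add: lookup_single when_def)
  moreover have "\<gamma> \<in> mindices n \<Longrightarrow> \<gamma> \<notin> S \<Longrightarrow> M (msize \<gamma>) 1 \<gamma> \<alpha>' = 0" "\<gamma> \<in> S \<Longrightarrow> \<gamma> \<in> mindices n"
    using S by blast+
  ultimately show ?thesis
    using S(1) by auto
qed

lemma bmat_mult_zero_column:
  assumes "\<And>q \<beta>. B q p' \<beta> \<alpha>' = 0"
  shows "bmat_mult n A B p p' \<alpha> \<alpha>' = 0"
  unfolding bmat_mult_def by (simp add: assms)

lemma taylor_bmat_finitely_many_rows: "finite {p. taylor_bmat n n' \<phi> p 1 \<noteq> (\<lambda>\<alpha> \<alpha>'. 0)}"
proof (rule finite_subset)
  show "{p. taylor_bmat n n' \<phi> p 1 \<noteq> (\<lambda>\<alpha> \<alpha>'. 0)} \<subseteq> msize ` (\<Union>j<n'. keys (\<phi> j))"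
  proof safe
    fix p assume p: "taylor_bmat n n' \<phi> p 1 \<noteq> (\<lambda>\<alpha> \<alpha>'. 0)"
    show "p \<in> msize ` (\<Union>j<n'. keys (\<phi> j))"
    proof (rule ccontr)
      assume *: "p \<notin> msize ` (\<Union>j<n'. keys (\<phi> j))"
      have "lookup (\<phi> j) \<alpha> = 0" if "j < n'" "\<alpha> \<in> mindices_of_size n p" for j \<alpha>
        using that * by (force simp: mindices_of_size_def in_keys_iff)
      then have "taylor_bmat n n' \<phi> p 1 = (\<lambda>\<alpha> \<alpha>'. 0)"
        unfolding taylor_bmat_def by (intro ext sum.neutral) auto
      with p show False by blast
    qed
  qed
qed simp

lemma row_bmat_zero:
  assumes "\<not> (\<exists>j<m. \<alpha>' = munit j) \<or> p' \<noteq> 1 \<or> \<alpha> \<noteq> 0 \<or> p \<noteq> 0"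
  shows "row_bmat m v p p' \<alpha> \<alpha>' = 0"
  unfolding row_bmat_def using assms by (intro sum.neutral) auto

lemma row_bmat_munit:
  assumes "j < m"
  shows "row_bmat m v p 1 \<alpha> (munit j) = (if p = 0 \<and> \<alpha> = 0 then v j else 0)"
  unfolding row_bmat_def using assms by (simp add: munit_eq_iff)

lemma is_matrix_of_taylor_bmat:
  assumes "poly_map n m \<phi>"
  shows "is_matrix_of_map n m \<phi> (taylor_bmat n m \<phi>)"
  unfolding is_matrix_of_map_def
proof (intro conjI taylor_bmat_in_bmats taylor_bmat_finitely_many_rows)
  show "\<forall>p p'. p' \<noteq> 1 \<longrightarrow> taylor_bmat n m \<phi> p p' = (\<lambda>\<alpha> \<alpha>'. 0)"
    by (intro allI impI ext taylor_bmat_zero) simp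
  show "row_bmat m \<phi> =
      bmat_mult n (Exp n n (row_bmat n mvar)) (\<lambda>p p' \<alpha> \<alpha>'. mconst (taylor_bmat n m \<phi> p p' \<alpha> \<alpha>'))"
  proof (intro ext)
    fix p p' and \<alpha> \<alpha>' :: mindex
    show "row_bmat m \<phi> p p' \<alpha> \<alpha>' =
      bmat_mult n (Exp n n (row_bmat n mvar)) (\<lambda>p p' \<alpha> \<alpha>'. mconst (taylor_bmat n m \<phi> p p' \<alpha> \<alpha>')) p p' \<alpha> \<alpha>'"
    proof (cases "p' = 1 \<and> (\<exists>j<m. \<alpha>' = munit j)")
      case True
      then obtain j where j: "j < m" and [simp]: "p' = 1" "\<alpha>' = munit j" by auto
      have \<phi>: "lookup (\<phi> j) \<gamma> = 0" if "\<gamma> \<notin> mindices n" for \<gamma>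
        using assms j that unfolding poly_map_def mpolys_def
        by (metis (mono_tags, lifting) in_keys_iff mem_Collect_eq subsetD)
      have "rat_emb (1 / of_nat (mfact \<gamma>)) * (of_nat (mfact \<gamma>) * lookup (\<phi> j) \<gamma>) = lookup (\<phi> j) \<gamma>" for \<gamma>
        using of_nat_mult_rat_emb_inverse[OF mfact_pos[of \<gamma>], where 'a='a]
        by (metis mult.assoc mult.commute mult_1_left)
      then have "lookup (row_bmat m \<phi> p 1 \<alpha> (munit j)) \<gamma> = (if p = 0 \<and> \<alpha> = 0 \<and> \<gamma> \<in> mindices n
         then rat_emb (1 / of_nat (mfact \<gamma>)) * taylor_bmat n m \<phi> (msize \<gamma>) 1 \<gamma> (munit j) else 0)" for \<gamma>
        unfolding row_bmat_munit[OF j] taylor_bmat_munit[OF j]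
        using \<phi> by (auto simp: mindices_of_size_def)
      then show ?thesis
        by (intro poly_mapping_eqI)
          (simp only: \<open>p' = 1\<close> \<open>\<alpha>' = munit j\<close> lookup_Exp_row_mult[where M="taylor_bmat n m \<phi>", OF taylor_bmat_finitely_many_rows])
    next
      case False
      then have "taylor_bmat n m \<phi> q p' \<beta> \<alpha>' = 0" for q \<beta>
        by (auto intro!: taylor_bmat_zero)
      then have "bmat_mult n (Exp n n (row_bmat n mvar)) (\<lambda>p p' \<alpha> \<alpha>'. mconst (taylor_bmat n m \<phi> p p' \<alpha> \<alpha>')) p p' \<alpha> \<alpha>' = 0"
        by (intro bmat_mult_zero_column) (simp add: mconst_def)
      then show ?thesis using False by (auto intro!: row_bmat_zero)
    qed
  qed
qed

lemma matrix_of_map_unique: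
  assumes "is_matrix_of_map n m \<phi> M" and "is_matrix_of_map n m \<phi> N"
  shows "M = N"
proof (intro ext)
  fix p p' and \<gamma> \<alpha>' :: mindex
  have M: "M \<in> bmats n m" "p' \<noteq> 1 \<Longrightarrow> M p p' = (\<lambda>\<alpha> \<alpha>'. 0)" "finite {p. M p 1 \<noteq> (\<lambda>\<alpha> \<alpha>'. 0)}"
    and N: "N \<in> bmats n m" "p' \<noteq> 1 \<Longrightarrow> N p p' = (\<lambda>\<alpha> \<alpha>'. 0)" "finite {p. N p 1 \<noteq> (\<lambda>\<alpha> \<alpha>'. 0)}"
    and eq: "bmat_mult n (Exp n n (row_bmat n mvar)) (\<lambda>p p' \<alpha> \<alpha>'. mconst (M p p' \<alpha> \<alpha>')) =
      bmat_mult n (Exp n n (row_bmat n mvar)) (\<lambda>p p' \<alpha> \<alpha>'. mconst (N p p' \<alpha> \<alpha>'))"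
    using assms unfolding is_matrix_of_map_def by metis+
  show "M p p' \<gamma> \<alpha>' = N p p' \<gamma> \<alpha>'"
  proof (cases "p' = 1 \<and> \<gamma> \<in> mindices_of_size n p")
    case True
    have cancel: "u = v" if "rat_emb (1 / of_nat (mfact \<gamma>)) * u = rat_emb (1 / of_nat (mfact \<gamma>)) * v" for u v :: 'a
      using of_nat_mult_rat_emb_inverse[OF mfact_pos[of \<gamma>], where 'a='a] that
      by (metis mult.assoc mult_1_left)
    have "lookup (bmat_mult n (Exp n n (row_bmat n mvar)) (\<lambda>p p' \<alpha> \<alpha>'. mconst (M p p' \<alpha> \<alpha>')) 0 1 0 \<alpha>') \<gamma> =
      lookup (bmat_mult n (Exp n n (row_bmat n mvar)) (\<lambda>p p' \<alpha> \<alpha>'. mconst (N p p' \<alpha> \<alpha>')) 0 1 0 \<alpha>') \<gamma>"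
      by (simp only: eq)
    then show ?thesis
      unfolding lookup_Exp_row_mult[where M=M, OF M(3)] lookup_Exp_row_mult[where M=N, OF N(3)]
      using True by (auto simp: mindices_of_size_def dest: cancel)
  next
    case False
    then show ?thesis
      using M(2) N(2) bmats_zero[OF M(1)] bmats_zero[OF N(1)] by metis
  qed
qed

lemma matrix_of_map_eq_taylor_bmat:
  assumes "poly_map n m \<phi>"
  shows "matrix_of_map n m \<phi> = taylor_bmat n m \<phi>"
  unfolding matrix_of_map_def
proof (rule the_equality)
  show "is_matrix_of_map n m \<phi> (taylor_bmat n m \<phi>)"
    using assms by (rule is_matrix_of_taylor_bmat)
  then show "M = taylor_bmat n m \<phi>" if "is_matrix_of_map n m \<phi> M" for M
    using that matrix_of_map_unique by blast
qed

section \<open>Composition\<close>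

lemma mpolys_mult: "f \<in> mpolys n \<Longrightarrow> g \<in> mpolys n \<Longrightarrow> f * g \<in> mpolys n" for f g :: "'a::comm_ring_1 mpoly"
  using keys_mult[of f g] by (fastforce simp: mpolys_def intro: mindices_add)

lemma mpolys_const: "mconst c \<in> mpolys n"
  by (simp add: mpolys_def mconst_def mindices_def)

lemma mpolys_one: "(1 :: 'a::comm_ring_1 mpoly) \<in> mpolys n"
  by (simp add: mpolys_def mindices_def)

lemma mpolys_power: "f \<in> mpolys n \<Longrightarrow> f ^ k \<in> mpolys n" for f :: "'a::comm_ring_1 mpoly"
  by (induction k) (simp_all add: mpolys_mult mpolys_one)

lemma mpolys_prod: "(\<And>i. i \<in> K \<Longrightarrow> f i \<in> mpolys n) \<Longrightarrow> prod f K \<in> mpolys n"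
  for f :: "'i \<Rightarrow> 'a::comm_ring_1 mpoly"
  by (induction K rule: infinite_finite_induct) (simp_all add: mpolys_mult mpolys_one)

lemma mpolys_sum: "(\<And>i. i \<in> K \<Longrightarrow> f i \<in> mpolys n) \<Longrightarrow> sum f K \<in> mpolys n"
  for f :: "'i \<Rightarrow> 'a::comm_ring_1 mpoly"
  using keys_sum[of f K] unfolding mpolys_def by blast

lemma poly_map_comp_poly_map:
  assumes "poly_map n n' \<phi>" "poly_map n'' n \<psi>"
  shows "poly_map n'' n' (poly_map_comp \<phi> \<psi> :: nat \<Rightarrow> 'a::comm_ring_1 mpoly)"
  unfolding poly_map_def
proof (intro allI impI)
  fix j assume j: "j < n'"
  have "\<psi> i \<in> mpolys n''" if "\<alpha> \<in> keys (\<phi> j)" "i \<in> keys \<alpha>" for \<alpha> i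
  proof -
    have "i < n" using assms(1) j that by (auto simp: poly_map_def mpolys_def mindices_def)
    then show ?thesis using assms(2) by (simp add: poly_map_def)
  qed
  then show "poly_map_comp \<phi> \<psi> j \<in> mpolys n''"
    unfolding poly_map_comp_def mpoly_subst_def
    by (intro mpolys_sum mpolys_mult mpolys_const mpolys_prod mpolys_power)
qed

lemma lookup_mpoly_subst:
  "lookup (mpoly_subst \<psi> f) \<alpha> = (\<Sum>\<beta>\<in>keys f. lookup f \<beta> * lookup (power_product \<psi> \<beta>) \<alpha>)"
  unfolding mpoly_subst_def power_product_def by (simp add: lookup_sum lookup_mconst_mult)

text \<open>
  The theorem for Taylor tables: the entry of $\mathrm{Exp}(M_\psi)$ carries the factor
  $\alpha!/\beta!$ and the entry of $M_\varphi$ the factor $\beta!$, so the product sums the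
  coefficients of $\psi^\beta$ with the weights $[x^\beta]\varphi_j$, which is substitution.
\<close>

lemma Exp_mult_taylor_bmat:
  assumes "poly_map n n' \<phi>"
  shows "bmat_mult n (Exp n'' n (taylor_bmat n'' n \<psi>)) (taylor_bmat n n' \<phi>) =
    taylor_bmat n'' n' (poly_map_comp \<phi> \<psi>)"
proof (intro ext)
  fix p p' and \<alpha> \<alpha>' :: mindex
  let ?E = "Exp n'' n (taylor_bmat n'' n \<psi>)"
  show "bmat_mult n ?E (taylor_bmat n n' \<phi>) p p' \<alpha> \<alpha>' = taylor_bmat n'' n' (poly_map_comp \<phi> \<psi>) p p' \<alpha> \<alpha>'"
  proof (cases "p' = 1 \<and> (\<exists>j<n'. \<alpha>' = munit j)")
    case True
    then obtain j where j: "j < n'" and \<alpha>': "p' = 1" "\<alpha>' = munit j" by auto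
    have keys: "keys (\<phi> j) \<subseteq> mindices n"
      using assms j by (simp add: poly_map_def mpolys_def)
    have entry: "?E p (msize \<beta>) \<alpha> \<beta> * taylor_bmat n n' \<phi> (msize \<beta>) 1 \<beta> (munit j) =
        (if \<alpha> \<in> mindices_of_size n'' p
         then of_nat (mfact \<alpha>) * (lookup (\<phi> j) \<beta> * lookup (power_product \<psi> \<beta>) \<alpha>) else 0)"
      if "\<beta> \<in> keys (\<phi> j)" for \<beta>
    proof -
      have "rat_emb (of_nat (mfact \<alpha>) / of_nat (mfact \<beta>)) * of_nat (mfact \<beta>) =
          (rat_emb (of_nat (mfact \<alpha>) / of_nat (mfact \<beta>) * of_nat (mfact \<beta>)) :: 'a)"
        by (simp only: rat_emb_mult rat_emb_of_nat)
      also have "\<dots> = of_nat (mfact \<alpha>)"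
        using mfact_pos[of \<beta>] by (simp add: rat_emb_of_nat)
      finally have c: "rat_emb (of_nat (mfact \<alpha>) / of_nat (mfact \<beta>)) * of_nat (mfact \<beta>) = (of_nat (mfact \<alpha>) :: 'a)" .
      have "\<beta> \<in> mindices_of_size n (msize \<beta>)"
        using keys that by (auto simp: mindices_of_size_def)
      then show ?thesis
        using j by (simp add: Exp_taylor_bmat taylor_bmat_munit ac_simps flip: c)
    qed
    have "bmat_mult n ?E (taylor_bmat n n' \<phi>) p 1 \<alpha> (munit j) =
        (\<Sum>\<beta>\<in>keys (\<phi> j). ?E p (msize \<beta>) \<alpha> \<beta> * taylor_bmat n n' \<phi> (msize \<beta>) 1 \<beta> (munit j))"
      using keys by (intro bmat_mult_entry) (use j in \<open>auto simp: taylor_bmat_munit in_keys_iff split: if_splits\<close>)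
    also have "\<dots> = (\<Sum>\<beta>\<in>keys (\<phi> j). if \<alpha> \<in> mindices_of_size n'' p
         then of_nat (mfact \<alpha>) * (lookup (\<phi> j) \<beta> * lookup (power_product \<psi> \<beta>) \<alpha>) else 0)"
      by (rule sum.cong[OF refl entry])
    also have "\<dots> = taylor_bmat n'' n' (poly_map_comp \<phi> \<psi>) p 1 \<alpha> (munit j)"
      using j by (simp add: taylor_bmat_munit poly_map_comp_def lookup_mpoly_subst sum_distrib_left)
    finally show ?thesis by (simp only: \<alpha>')
  next
    case False
    then have "taylor_bmat n n' \<phi> q p' \<beta> \<alpha>' = 0" for q \<beta>
      by (auto intro!: taylor_bmat_zero)
    then have "bmat_mult n ?E (taylor_bmat n n' \<phi>) p p' \<alpha> \<alpha>' = 0"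
      by (rule bmat_mult_zero_column)
    moreover have "taylor_bmat n'' n' (poly_map_comp \<phi> \<psi>) p p' \<alpha> \<alpha>' = 0"
      using False by (intro taylor_bmat_zero) blast
    ultimately show ?thesis by simp
  qed
qed

theorem theorem3:
  fixes n n' n'' :: nat
    and \<phi> \<psi> :: "nat \<Rightarrow> 'a::comm_ring_rat mpoly"
  assumes "n > 0" and "n' > 0"
    and "poly_map n n' \<phi>"
    and "poly_map n'' n \<psi>"
  shows "matrix_of_map n'' n' (poly_map_comp \<phi> \<psi>) =
    bmat_mult n (Exp n'' n (matrix_of_map n'' n \<psi>)) (matrix_of_map n n' \<phi>)"
  using assms(3,4)
  by (simp add: matrix_of_map_eq_taylor_bmat poly_map_comp_poly_map Exp_mult_taylor_bmat)

end
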